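(* Let $I\subseteq\mathbb R$ be a compact interval, $M>0$, and let $\gamma:\mathbb R\to\mathbb R$ be a $C^1$ function with $\sup_{t\in\mathbb R}|\gamma'(t)|\le 1$, with $$M^{-1}|s-t|\le|\gamma'(s)-\gamma'(t)|\le M|s-t|\quad\text{for all } s,t\in I,$$ and with $\gamma'$ strictly decreasing on $I$. Let $\Lambda\subseteq\mathbb R$ be a compact set with $\Lambda-[0,1]\subseteq I$, and for $\lambda\in\Lambda$ define $\Phi_\lambda:[0,1]^2\to\mathbb R$ by $\Phi_\lambda(\mathbf a)=a_2+\gamma(\lambda-a_1)$ for $\mathbf a=(a_1,a_2)$. Let $\alpha,\alpha'\in\Lambda$ with $\alpha\neq\alpha'$. Then there is a constant $C>0$, depending only on $M$, $\alpha$ and $\alpha'$, such that the following holds. Let $E\subseteq[0,1]^2$ be a compact set, $N\ge 1$ an integer, and suppose that there exists a sequence of scales $0<r_N<r_{N-1}<\cdots<r_1\le 1$ with the following properties: (1) (Scale separation) each $r_n$ is a dyadic number, that is, $r_n=2^{-j_n}$ for some $j_n\in\mathbb N$; in particular $r_{n+1}\le\frac12 r_n$ for all $1\le n<N$. (2) (Small projections) $\mathcal L^1(\mathcal N_{r_{n+1}}(\Phi_\alpha(E)))\le r_n$ and $\mathcal L^1(\mathcal N_{r_{n+1}}(\Phi_{\alpha'}(E)))\le r_n$ for all $1\le n<N$. Then $$\mathcal R_{E,\mathrm{res}}\left(r_N,1,N^{1/100}\right)\le C\,N^{-1/100}.$$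
   Context: $\mathcal L^1$ is Lebesgue measure on $\mathbb R$; $\mathbb N$ includes $0$. For $G\subseteq\mathbb R$ and $r>0$, $\mathcal N_r(G)=\{x\in\mathbb R:d(x,G)<r\}$ is the open $r$-neighborhood. $\Lambda-[0,1]=\{\lambda-s:\lambda\in\Lambda,s\in[0,1]\}$. For a Lipschitz function $F:\mathbb R\to\mathbb R$, $\mathrm{Lip}(F)=\sup_{x\ne y}|F(x)-F(y)|/|x-y|$. Restricted rectifiability constant: for $E\subseteq\mathbb R^2$, $\varepsilon>0$, a bounded interval $J\subseteq\mathbb R$ of positive length, an orthonormal pair $(\omega_1,\omega_2)\in S^1\times S^1$ and a Lipschitz function $F:\mathbb R\to\mathbb R$, set $$R_E(\varepsilon,J,F,(\omega_1,\omega_2)):=\frac{\mathcal L^1(\{x\in J:\exists\,y\in[-\varepsilon,\varepsilon]\text{ such that }x\omega_1+(F(x)+y)\omega_2\in E\})}{\mathcal L^1(J)}.$$ With $e_1=(1,0)$, $e_2=(0,1)$, for $\rho,K\ge0$, $$\mathcal R_{E,\mathrm{res}}(\varepsilon,\rho,K):=\sup_{\mathcal L^1(J)\ge \rho,\ \mathrm{Lip}(F)\le K}\max\{R_E(\varepsilon,J,F,(e_1,e_2)),\,R_E(\varepsilon,J,F,(e_2,e_1))\}.$$ *)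

theory Defs
  imports "HOL-Analysis.Analysis"
begin

(* Written as a union of balls rather than with infdist, because infdist x {} = 0,
   whereas d(x,{}) is infinite and the neighbourhood of the empty set is empty. *)
definition open_nbhd :: "real \<Rightarrow> real set \<Rightarrow> real set" where
  "open_nbhd r G = (\<Union>g\<in>G. ball g r)"

definition Phi :: "(real \<Rightarrow> real) \<Rightarrow> real \<Rightarrow> real \<times> real \<Rightarrow> real" where
  "Phi \<gamma> l a = snd a + \<gamma> (l - fst a)"

definition Lipschitz_fun :: "(real \<Rightarrow> real) \<Rightarrow> bool" where
  "Lipschitz_fun F \<longleftrightarrow> (\<exists>L. L-lipschitz_on UNIV F)"

(* The supremum is taken in the reals, so this is only meaningful if Lipschitz_fun F. *)
definition Lip :: "(real \<Rightarrow> real) \<Rightarrow> real" where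
  "Lip F = Sup {\<bar>F x - F y\<bar> / \<bar>x - y\<bar> | x y. x \<noteq> y}"

definition R_E :: "(real \<times> real) set \<Rightarrow> real \<Rightarrow> real set \<Rightarrow> (real \<Rightarrow> real)
    \<Rightarrow> (real \<times> real) \<times> (real \<times> real) \<Rightarrow> real" where
  "R_E E \<epsilon> J F \<omega> =
     measure lebesgue
       {x \<in> J. \<exists>y\<in>{-\<epsilon>..\<epsilon>}. x *\<^sub>R fst \<omega> + (F x + y) *\<^sub>R snd \<omega> \<in> E}
     / measure lebesgue J"

definition R_res :: "(real \<times> real) set \<Rightarrow> real \<Rightarrow> real \<Rightarrow> real \<Rightarrow> real" where
  "R_res E \<epsilon> \<rho> K =
     Sup {max (R_E E \<epsilon> J F ((1, 0), (0, 1))) (R_E E \<epsilon> J F ((0, 1), (1, 0))) | J F.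
            is_interval J \<and> bounded J \<and> 0 < measure lebesgue J \<and> \<rho> \<le> measure lebesgue J \<and>
            Lipschitz_fun F \<and> Lip F \<le> K}"

(* The next two facts show that the real-valued Sup in R_res is over a nonempty set of
   numbers bounded by 1. *)
lemma R_E_le_1:
  assumes "is_interval J" "bounded J"
  shows "R_E E \<epsilon> J F \<omega> \<le> 1"
proof -
  let ?A = "{x \<in> J. \<exists>y\<in>{-\<epsilon>..\<epsilon>}. x *\<^sub>R fst \<omega> + (F x + y) *\<^sub>R snd \<omega> \<in> E}"
  have J: "J \<in> lmeasurable"
    using assms by (simp add: is_interval_convex_1 measurable_convex)
  have "measure lebesgue ?A \<le> measure lebesgue J"
  proof (cases "?A \<in> sets lebesgue")
    case True
    then show ?thesis
      by (intro measure_mono_fmeasurable J) auto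
  qed (simp add: measure_notin_sets)
  then show ?thesis
    unfolding R_E_def by (simp add: divide_le_eq_1 zero_less_measure_iff)
qed

lemma R_res_index_nonempty:
  assumes "0 \<le> K"
  shows "\<exists>(J :: real set) F. is_interval J \<and> bounded J \<and> 0 < measure lebesgue J \<and>
    \<rho> \<le> measure lebesgue J \<and> Lipschitz_fun F \<and> Lip F \<le> K"
proof -
  have "Lipschitz_fun (\<lambda>_. 0)"
    unfolding Lipschitz_fun_def by (rule exI[of _ 0]) (simp add: lipschitz_on_def)
  moreover have "{\<bar>0 - 0\<bar> / \<bar>x - y\<bar> | x y :: real. x \<noteq> y} = {0 :: real}"
    by (auto intro: exI[of _ "0::real"] exI[of _ "1::real"])
  then have "Lip (\<lambda>_. 0) \<le> K"
    using assms unfolding Lip_def by simp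
  moreover have "is_interval {0..max 1 \<rho>}" "bounded {0..max 1 \<rho>}"
    "0 < measure lebesgue {0..max 1 \<rho>}" "\<rho> \<le> measure lebesgue {0..max 1 \<rho>}"
    by (auto simp: is_interval_cc)
  ultimately show ?thesis
    by (intro exI[of _ "{0..max 1 \<rho>}"] exI[of _ "\<lambda>_. 0"] conjI)
qed

end

theory Submission
  imports Defs
begin

text \<open>
  Along the graph of \<open>F\<close>, parametrised by the coordinate \<open>x\<close>, the two projections become Lipschitz
  functions \<open>f\<close>, \<open>g\<close> of \<open>x\<close>. The lower bound on \<open>|\<gamma>'(s) - \<gamma>'(t)|\<close> makes them transversal: over every interval
  in \<open>[0,1]\<close> at least one of them has average slope at least \<open>\<delta> > 0\<close> in absolute value.

  The energy \<open>2\<^sup>j \<Sum>(\<Delta>f)\<^sup>2\<close> over the dyadic intervals of length \<open>2\<^sup>-\<^sup>j\<close> is nondecreasing in \<open>j\<close> and bounded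
  by the square of the Lipschitz constant. Among many disjoint windows of scales, slightly larger than
  \<open>[r\<^sub>n\<^sub>+\<^sub>1, r\<^sub>n]\<close>, there is therefore one over which the energies of \<open>f\<close> and \<open>g\<close> hardly grow; there the fine
  slopes of \<open>f\<close> and \<open>g\<close> agree with the coarse ones except on a small set.

  On a coarse interval of length \<open>2\<^sup>m r\<^sub>n\<close> where \<open>f\<close> has slope at least \<open>\<delta>\<close>, the fine intervals meeting the
  set under consideration are mapped into \<open>G\<close>, the \<open>r\<^sub>n\<^sub>+\<^sub>1\<close>-neighbourhood of the projection, of measure
  at most \<open>r\<^sub>n\<close>. With \<open>m(t) = |G \<inter> (-\<infinity>, t]|\<close>, the increments of \<open>m \<circ> f\<close> over the fine intervals
  telescope to at most \<open>|G|\<close>, are nonnegative on fine intervals of good slope, and equal the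
  increments of \<open>f\<close> on those that meet the set. This bounds the number of the latter.
\<close>

section \<open>Counting the steps of a discrete path that lie in a set of small measure\<close>

lemma measure_Int_atMost_diff:
  fixes G :: "real set" and u v :: real
  assumes "G \<in> lmeasurable" "u \<le> v"
  defines "m \<equiv> \<lambda>y. measure lebesgue (G \<inter> {..y})"
  shows "0 \<le> m v - m u" "m v - m u \<le> v - u" "{u..v} \<subseteq> G \<Longrightarrow> m v - m u = v - u"
proof -
  have fm: "G \<inter> {..y} \<in> lmeasurable" for y
    using assms(1) by (intro fmeasurable.Int fmeasurable_Int_fmeasurable) auto
  have "m v - m u = measure lebesgue (G \<inter> {..v} - G \<inter> {..u})"
    unfolding m_def using assms(2) by (intro measurable_measure_Diff[symmetric] fm) (auto intro: fmeasurableD[OF fm])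
  also have "G \<inter> {..v} - G \<inter> {..u} = G \<inter> {u<..v}"
    by auto
  finally have eq: "m v - m u = measure lebesgue (G \<inter> {u<..v})" .
  show "0 \<le> m v - m u" by (simp add: eq)
  have "measure lebesgue (G \<inter> {u<..v}) \<le> measure lebesgue {u<..v}"
    using assms(1) by (intro measure_mono_fmeasurable) (auto simp: fmeasurableD intro: bounded_set_imp_lmeasurable)
  then show "m v - m u \<le> v - u" using assms(2) by (simp add: eq)
  assume "{u..v} \<subseteq> G"
  then have "G \<inter> {u<..v} = {u<..v}" by auto
  then show "m v - m u = v - u" using assms(2) by (simp add: eq)
qed

text \<open>The variance identity. It turns deviations of slopes from their average into a
  difference of sums of squares at two scales, hence of energies.\<close>

lemma sum_sq_dev_mean:
  fixes y :: "nat \<Rightarrow> real"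
  assumes "n > 0"
  defines "\<tau> \<equiv> (y n - y 0) / n"
  shows "(\<Sum>i<n. (y (Suc i) - y i - \<tau>)\<^sup>2) = (\<Sum>i<n. (y (Suc i) - y i)\<^sup>2) - (y n - y 0)\<^sup>2 / n"
proof -
  have s: "(\<Sum>i<n. y (Suc i) - y i) = n * \<tau>"
    using assms(1) by (simp add: sum_lessThan_telescope \<tau>_def)
  have "(\<Sum>i<n. (y (Suc i) - y i - \<tau>)\<^sup>2)
      = (\<Sum>i<n. (y (Suc i) - y i)\<^sup>2 - 2 * \<tau> * (y (Suc i) - y i) + \<tau>\<^sup>2)"
    by (intro sum.cong) (auto simp: power2_eq_square algebra_simps)
  also have "\<dots> = (\<Sum>i<n. (y (Suc i) - y i)\<^sup>2) - 2 * \<tau> * (\<Sum>i<n. y (Suc i) - y i) + n * \<tau>\<^sup>2"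
    by (simp add: sum.distrib sum_subtractf flip: sum_distrib_left)
  also have "\<dots> = (\<Sum>i<n. (y (Suc i) - y i)\<^sup>2) - n * \<tau>\<^sup>2"
    unfolding s by (simp add: power2_eq_square algebra_simps)
  also have "n * \<tau>\<^sup>2 = (y n - y 0)\<^sup>2 / n"
    using assms(1) by (simp add: \<tau>_def power2_eq_square)
  finally show ?thesis .
qed

text \<open>A step within \<open>c0 / 2\<close> of the mean step moves in the direction of the mean
  by at least \<open>c0 / 2\<close>, so a hit there uses up at least \<open>c0 / 2\<close> of the
  measure of \<open>G\<close>. Every other step has squared deviation at least
  \<open>c0\<^sup>2 / 4\<close>, and its possible loss \<open>c + c0 / 2\<close> is charged to the
  variance.\<close>

lemma hits_le_measure_plus_variance:
  fixes y :: "nat \<Rightarrow> real" and G :: "real set"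
  assumes n: "n > 0" and G: "G \<in> lmeasurable" and c0: "c0 > 0"
    and lip: "\<And>i. i < n \<Longrightarrow> \<bar>y (Suc i) - y i\<bar> \<le> c"
    and slope: "\<bar>y n - y 0\<bar> \<ge> n * c0"
    and hit: "\<And>i. i < n \<Longrightarrow> H i \<Longrightarrow> closed_segment (y i) (y (Suc i)) \<subseteq> G"
  shows "c0 / 2 * (\<Sum>i<n. of_bool (H i)) \<le> measure lebesgue G
    + (c + c0 / 2) * (4 / c0\<^sup>2) * ((\<Sum>i<n. (y (Suc i) - y i)\<^sup>2) - (y n - y 0)\<^sup>2 / n)"
proof -
  define \<tau> where "\<tau> = (y n - y 0) / n"
  \<comment> \<open>The sign of the mean step lets descending paths share the argument for ascending
    ones.\<close>
  define \<sigma> :: real where "\<sigma> = (if \<tau> \<ge> 0 then 1 else -1)"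
  define m where "m = (\<lambda>t. measure lebesgue (G \<inter> {..t}))"
  have mprops: "0 \<le> m v - m u" "m v - m u \<le> v - u" "{u..v} \<subseteq> G \<Longrightarrow> m v - m u = v - u"
    if "u \<le> v" for u v
    unfolding m_def using measure_Int_atMost_diff[OF G that] by auto
  have \<tau>: "\<sigma> * \<tau> \<ge> c0"
    using slope n by (auto simp: \<tau>_def \<sigma>_def field_simps abs_if split: if_splits)
  have c: "c \<ge> 0" using lip[of 0] n by linarith
  \<comment> \<open>On a deviating step \<open>m\<close> may go backwards by up to \<open>c\<close>,
    and a hit costs a further \<open>c0 / 2\<close>. The right-hand sides telescope when summed over
    \<open>i\<close>.\<close>
  have step: "c0 / 2 * of_bool (H i) - (c + c0 / 2) * (4 / c0\<^sup>2) * (y (Suc i) - y i - \<tau>)\<^sup>2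
      \<le> \<sigma> * (m (y (Suc i)) - m (y i))" if i: "i < n" for i
  proof (cases "\<bar>y (Suc i) - y i - \<tau>\<bar> \<ge> c0 / 2")
    case True
    have "(c0 / 2)\<^sup>2 \<le> (y (Suc i) - y i - \<tau>)\<^sup>2"
      using power_mono[OF True, of 2] c0 by simp
    then have "1 \<le> 4 / c0\<^sup>2 * (y (Suc i) - y i - \<tau>)\<^sup>2"
      using c0 by (simp add: field_simps power2_eq_square)
    then have "(c + c0 / 2) * 1 \<le> (c + c0 / 2) * (4 / c0\<^sup>2 * (y (Suc i) - y i - \<tau>)\<^sup>2)"
      using c c0 by (intro mult_left_mono) auto
    moreover have "\<bar>m (y (Suc i)) - m (y i)\<bar> \<le> c"
      using mprops(1,2)[of "y i" "y (Suc i)"] mprops(1,2)[of "y (Suc i)" "y i"] lip[OF i]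
      by linarith
    then have "- c \<le> \<sigma> * (m (y (Suc i)) - m (y i))"
      by (auto simp: \<sigma>_def)
    moreover have "c0 / 2 * of_bool (H i) \<le> c0 / 2"
      using c0 by auto
    ultimately show ?thesis unfolding mult.assoc mult_1_right by linarith
  next
    case False
    then have incr: "\<sigma> * (y (Suc i) - y i) \<ge> c0 / 2"
      using \<tau> unfolding \<sigma>_def by (cases "\<tau> \<ge> 0"; simp; linarith)
    have "\<sigma> * (m (y (Suc i)) - m (y i)) \<ge> c0 / 2 * of_bool (H i)"
    proof (cases "\<sigma> = 1")
      case True
      then have le: "y i \<le> y (Suc i)" using incr c0 by auto
      show ?thesis
        using mprops(1,3)[OF le] hit[OF i] le incr True c0
        by (auto simp: closed_segment_eq_real_ivl)
    next
      case False
      then have \<sigma>: "\<sigma> = -1" by (auto simp: \<sigma>_def split: if_splits)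
      then have le: "y (Suc i) \<le> y i" using incr c0 by auto
      show ?thesis
        using mprops(1,3)[OF le] hit[OF i] le incr \<sigma> c0
        by (auto simp: closed_segment_eq_real_ivl split: if_splits)
    qed
    moreover have "0 \<le> (c + c0 / 2) * (4 / c0\<^sup>2) * (y (Suc i) - y i - \<tau>)\<^sup>2"
      using c c0 by simp
    ultimately show ?thesis by linarith
  qed
  have "c0 / 2 * (\<Sum>i<n. of_bool (H i)) - (c + c0 / 2) * (4 / c0\<^sup>2) * (\<Sum>i<n. (y (Suc i) - y i - \<tau>)\<^sup>2)
      \<le> (\<Sum>i<n. \<sigma> * (m (y (Suc i)) - m (y i)))"
    unfolding sum_distrib_left sum_subtractf[symmetric] by (intro sum_mono step) auto
  also have "\<dots> = \<sigma> * (m (y n) - m (y 0))"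
    by (simp add: sum_distrib_left[symmetric] sum_lessThan_telescope[where f="\<lambda>i. m (y i)"])
  also have "\<dots> \<le> measure lebesgue G"
  proof -
    have "0 \<le> m t \<and> m t \<le> measure lebesgue G" for t
      unfolding m_def using G by (auto intro!: measure_mono_fmeasurable sets.Int dest: fmeasurableD)
    from this[of "y n"] this[of "y 0"] show ?thesis by (auto simp: \<sigma>_def)
  qed
  finally show ?thesis
    unfolding \<tau>_def sum_sq_dev_mean[OF n] by linarith
qed

section \<open>Energy of a function over dyadic grids\<close>

lemma sum_lessThan_blocks:
  fixes f :: "nat \<Rightarrow> 'a::comm_monoid_add"
  shows "(\<Sum>i<a * k. f i) = (\<Sum>u<a. \<Sum>v<k. f (u * k + v))"
proof -
  have "(\<Sum>i\<in>{u * k..<u * k + k}. f i) = (\<Sum>v<k. f (u * k + v))" for u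
    using sum.shift_bounds_nat_ivl[of f 0 "u * k" k] by (simp add: lessThan_atLeast0 add.commute)
  then show ?thesis by (simp flip: sum.nat_group)
qed

text \<open>This is the integral over [0,1] of the squared slope of the piecewise linear
  interpolation of \<open>f\<close> at the points \<open>i / 2 ^ j\<close>.\<close>

definition energy :: "(real \<Rightarrow> real) \<Rightarrow> nat \<Rightarrow> real" where
  "energy f j = 2 ^ j * (\<Sum>i<2 ^ j. (f (real (Suc i) / 2 ^ j) - f (real i / 2 ^ j))\<^sup>2)"

text \<open>The sum of squared deviations of the increments of \<open>f\<close> at scale \<open>2\<^sup>-\<^sup>(\<^sup>a\<^sup>+\<^sup>d\<^sup>)\<close> from their mean over the
  \<open>u\<close>-th dyadic interval of length \<open>2\<^sup>-\<^sup>a\<close>.\<close>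

definition block_variance :: "(real \<Rightarrow> real) \<Rightarrow> nat \<Rightarrow> nat \<Rightarrow> nat \<Rightarrow> real" where
  "block_variance f a d u =
     (\<Sum>v<2 ^ d. (f (real (Suc (u * 2 ^ d + v)) / 2 ^ (a + d)) - f (real (u * 2 ^ d + v) / 2 ^ (a + d)))\<^sup>2)
     - (f (real (Suc u) / 2 ^ a) - f (real u / 2 ^ a))\<^sup>2 / 2 ^ d"

lemma block_ends:
  "real (u * 2 ^ d) / 2 ^ (a + d) = real u / 2 ^ a"
  "real (u * 2 ^ d + 2 ^ d) / 2 ^ (a + d) = real (Suc u) / 2 ^ a"
  by (simp_all add: power_add field_simps)

lemma block_variance_nonneg: "0 \<le> block_variance f a d u"
proof -
  define y where "y = (\<lambda>v. f (real (u * 2 ^ d + v) / 2 ^ (a + d)))"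
  have "block_variance f a d u = (\<Sum>i<2 ^ d. (y (Suc i) - y i)\<^sup>2) - (y (2 ^ d) - y 0)\<^sup>2 / real (2 ^ d)"
    unfolding block_variance_def y_def by (simp only: block_ends add_Suc_right add_0_right) simp
  also have "\<dots> = (\<Sum>i<2 ^ d. (y (Suc i) - y i - (y (2 ^ d) - y 0) / real (2 ^ d))\<^sup>2)"
    by (rule sum_sq_dev_mean[symmetric]) simp
  also have "\<dots> \<ge> 0" by (simp add: sum_nonneg)
  finally show ?thesis .
qed

text \<open>A Pythagorean identity: within each coarse interval the squared mean slope accounts for
  the coarse energy, and what remains is the variance of the fine slopes. Little growth of energy
  thus forces most fine slopes to be close to the coarse ones.\<close>

lemma energy_diff: "energy f (a + d) - energy f a = 2 ^ (a + d) * (\<Sum>u<2 ^ a. block_variance f a d u)"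
proof -
  have "energy f (a + d) = 2 ^ (a + d) * (\<Sum>u<2 ^ a. \<Sum>v<2 ^ d.
      (f (real (Suc (u * 2 ^ d + v)) / 2 ^ (a + d)) - f (real (u * 2 ^ d + v) / 2 ^ (a + d)))\<^sup>2)"
    unfolding energy_def power_add[of "2 :: nat"] by (subst sum_lessThan_blocks) (rule refl)
  moreover have "energy f a = 2 ^ (a + d) * (\<Sum>u<2 ^ a. (f (real (Suc u) / 2 ^ a) - f (real u / 2 ^ a))\<^sup>2 / 2 ^ d)"
    unfolding energy_def by (simp add: sum_divide_distrib[symmetric] power_add)
  ultimately show ?thesis
    unfolding block_variance_def by (simp only: sum_subtractf right_diff_distrib)
qed

lemma energy_mono: "a \<le> b \<Longrightarrow> energy f a \<le> energy f b"
proof -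
  assume "a \<le> b"
  then have "energy f b - energy f a = 2 ^ b * (\<Sum>u<2 ^ a. block_variance f a (b - a) u)"
    using energy_diff[of f a "b - a"] by simp
  also have "\<dots> \<ge> 0" by (simp add: sum_nonneg block_variance_nonneg)
  finally show ?thesis by simp
qed

lemma energy_nonneg: "0 \<le> energy f j"
  unfolding energy_def by (simp add: sum_nonneg)

lemma grid_points_in_unit:
  assumes "i < 2 ^ j"
  shows "real i / 2 ^ j \<in> {0..1}" "real (Suc i) / 2 ^ j \<in> {0..1}"
proof -
  have "real (Suc i) \<le> real (2 ^ j)"
    using assms by (intro of_nat_mono) simp
  then have "1 + real i \<le> 2 ^ j" by simp
  then show "real i / 2 ^ j \<in> {0..1}" "real (Suc i) / 2 ^ j \<in> {0..1}"
    using assms by (simp_all add: divide_le_eq_1)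
qed

lemma lipschitz_grid_increment:
  fixes f :: "real \<Rightarrow> real"
  assumes "L-lipschitz_on {0..1} f" "i < 2 ^ j"
  shows "\<bar>f (real (Suc i) / 2 ^ j) - f (real i / 2 ^ j)\<bar> \<le> L / 2 ^ j"
proof -
  have "\<bar>f (real (Suc i) / 2 ^ j) - f (real i / 2 ^ j)\<bar> \<le> L * \<bar>real (Suc i) / 2 ^ j - real i / 2 ^ j\<bar>"
    using lipschitz_onD[OF assms(1) grid_points_in_unit(2,1)[OF assms(2)]]
    by (simp only: dist_real_def)
  also have "\<dots> = L / 2 ^ j" by (simp add: diff_divide_distrib[symmetric])
  finally show ?thesis .
qed

lemma energy_le_square_lipschitz:
  assumes "L-lipschitz_on {0..1} f"
  shows "energy f j \<le> L\<^sup>2"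
proof -
  have "(f (real (Suc i) / 2 ^ j) - f (real i / 2 ^ j))\<^sup>2 \<le> (L / 2 ^ j)\<^sup>2" if "i < 2 ^ j" for i
    using power_mono[OF lipschitz_grid_increment[OF assms that], of 2] by simp
  then have "energy f j \<le> 2 ^ j * (\<Sum>i<(2::nat) ^ j. (L / 2 ^ j)\<^sup>2)"
    unfolding energy_def by (intro mult_left_mono sum_mono) auto
  also have "\<dots> = L\<^sup>2" by (simp add: power2_eq_square field_simps)
  finally show ?thesis .
qed

section \<open>Dyadic covers, and measure bounds by energy growth\<close>

definition meets_cell :: "real set \<Rightarrow> nat \<Rightarrow> nat \<Rightarrow> bool" where
  "meets_cell A j i \<longleftrightarrow> (\<exists>x\<in>A. real i / 2 ^ j \<le> x \<and> x \<le> real (Suc i) / 2 ^ j)"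

text \<open>The cells that meet \<open>A\<close> cover it. A set that is not Lebesgue measurable has
  \<open>measure\<close> 0 by convention, so the sets in \<open>R_E\<close> can be inserted without
  a proof of their measurability.\<close>

lemma measure_le_cells:
  assumes "A \<subseteq> {0..1}"
  shows "measure lebesgue A \<le> (\<Sum>i<2 ^ j. of_bool (meets_cell A j i)) / 2 ^ j"
proof (cases "A \<in> sets lebesgue")
  case True
  define K where "K = {i. i < 2 ^ j \<and> meets_cell A j i}"
  define c where "c = (\<lambda>i. {real i / 2 ^ j..real (Suc i) / 2 ^ j})"
  have fin: "finite K" unfolding K_def by simp
  have "A \<subseteq> (\<Union>i\<in>K. c i)"
  proof
    fix x assume x: "x \<in> A"
    then have x01: "0 \<le> x" "x \<le> 1" using assms by auto
    \<comment> \<open>The minimum puts the point 1 into the last cell, where the floor alone would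
      give the index \<open>2 ^ j\<close>.\<close>
    define i where "i = min (nat \<lfloor>x * 2 ^ j\<rfloor>) (2 ^ j - 1)"
    have "i < 2 ^ j" unfolding i_def by (simp add: min_less_iff_disj)
    moreover have "real i \<le> x * 2 ^ j"
    proof -
      have "real i \<le> real (nat \<lfloor>x * 2 ^ j\<rfloor>)" unfolding i_def by simp
      also have "\<dots> \<le> x * 2 ^ j" using x01 by simp
      finally show ?thesis .
    qed
    moreover have "x * 2 ^ j \<le> real (Suc i)"
    proof (cases "nat \<lfloor>x * 2 ^ j\<rfloor> \<le> 2 ^ j - 1")
      case True
      then show ?thesis unfolding i_def using x01 by simp linarith
    next
      case False
      then have "real (Suc i) = 2 ^ j" unfolding i_def by (simp add: min_def of_nat_diff)
      then show ?thesis using x01 by simp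
    qed
    ultimately have "i < 2 ^ j" "real i / 2 ^ j \<le> x" "x \<le> real (Suc i) / 2 ^ j"
      by (simp_all add: field_simps)
    then show "x \<in> (\<Union>i\<in>K. c i)"
      using x unfolding K_def c_def meets_cell_def by auto
  qed
  then have "measure lebesgue A \<le> measure lebesgue (\<Union>i\<in>K. c i)"
    using True fin by (intro measure_mono_fmeasurable fmeasurable.finite_UN) (auto simp: c_def)
  also have "\<dots> \<le> (\<Sum>i\<in>K. measure lebesgue (c i))"
    using fin by (intro measure_UNION_le) (auto simp: c_def)
  also have "\<dots> = (\<Sum>i\<in>K. 1 / 2 ^ j)"
    by (intro sum.cong) (auto simp: c_def diff_divide_distrib[symmetric] divide_right_mono)
  also have "\<dots> = (\<Sum>i<2 ^ j. of_bool (meets_cell A j i)) / 2 ^ j"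
    by (simp add: K_def sum_of_bool_eq Int_def)
  finally show ?thesis .
qed (simp add: measure_notin_sets sum_nonneg)

text \<open>The hit count is applied to the values of \<open>h\<close> at the fine grid points of
  one coarse interval. A fine cell has length \<open>1 / 2 ^ (a + d)\<close>, so if it meets
  \<open>A\<close> at \<open>x\<close>, then \<open>h\<close> at both of its ends is within
  \<open>L / 2 ^ (a + d)\<close> of \<open>h x\<close>, and the segment between these values lies in
  \<open>G\<close>.\<close>

lemma block_hits_le:
  fixes h :: "real \<Rightarrow> real"
  assumes \<delta>: "\<delta> > 0" and lip: "L-lipschitz_on {0..1} h" and A: "A \<subseteq> {0..1}"
    and G: "G \<in> lmeasurable"
    and near: "\<forall>x\<in>A. cball (h x) (L / 2 ^ (a + d)) \<subseteq> G"
    and u: "u < 2 ^ a"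
    and slope: "\<delta> / 2 ^ a \<le> \<bar>h (real (Suc u) / 2 ^ a) - h (real u / 2 ^ a)\<bar>"
  shows "\<delta> / 2 * ((\<Sum>v<2 ^ d. of_bool (meets_cell A (a + d) (u * 2 ^ d + v))) / 2 ^ (a + d))
    \<le> measure lebesgue G + (L + \<delta> / 2) * (4 / \<delta>\<^sup>2) * (2 ^ (a + d) * block_variance h a d u)"
proof -
  define B :: real where "B = 2 ^ (a + d)"
  have B: "B > 0" unfolding B_def by simp
  define y where "y = (\<lambda>v. h (real (u * 2 ^ d + v) / B))"
  have idx: "u * 2 ^ d + v < 2 ^ (a + d)" if "v < 2 ^ d" for v
  proof -
    have "u * 2 ^ d + v < Suc u * 2 ^ d" using that by simp
    also have "\<dots> \<le> 2 ^ a * 2 ^ d" using u by (intro mult_right_mono) auto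
    finally show ?thesis by (simp add: power_add)
  qed
  have Suc_y: "y (Suc v) = h (real (Suc (u * 2 ^ d + v)) / B)" for v
    by (simp add: y_def add_ac)
  have L: "L \<ge> 0" using lip by (rule lipschitz_on_nonneg)
  have ends: "y 0 = h (real u / 2 ^ a)" "y (2 ^ d) = h (real (Suc u) / 2 ^ a)"
    unfolding y_def B_def by (simp_all only: block_ends add_0_right)
  have main: "\<delta> / B / 2 * (\<Sum>v<2 ^ d. of_bool (meets_cell A (a + d) (u * 2 ^ d + v)))
    \<le> measure lebesgue G + (L / B + \<delta> / B / 2) * (4 / (\<delta> / B)\<^sup>2)
       * ((\<Sum>v<2 ^ d. (y (Suc v) - y v)\<^sup>2) - (y (2 ^ d) - y 0)\<^sup>2 / real (2 ^ d))"
  proof (rule hits_le_measure_plus_variance[OF _ G])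
    show "\<bar>y (Suc v) - y v\<bar> \<le> L / B" if "v < 2 ^ d" for v
      using lipschitz_grid_increment[OF lip idx[OF that]] unfolding Suc_y
      by (simp add: y_def B_def)
    show "real (2 ^ d) * (\<delta> / B) \<le> \<bar>y (2 ^ d) - y 0\<bar>"
      using slope unfolding ends by (simp add: B_def power_add)
    show "closed_segment (y v) (y (Suc v)) \<subseteq> G"
      if v: "v < 2 ^ d" and hit: "meets_cell A (a + d) (u * 2 ^ d + v)" for v
    proof
      fix t assume t: "t \<in> closed_segment (y v) (y (Suc v))"
      define i where "i = u * 2 ^ d + v"
      obtain x where x: "x \<in> A" "real i / B \<le> x" "x \<le> real (Suc i) / B"
        using hit unfolding meets_cell_def i_def B_def by blast
      note cell_ends = grid_points_in_unit[OF idx[OF v], folded i_def B_def]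
      have w: "real (Suc i) / B = real i / B + 1 / B"
        by (simp add: add_divide_distrib)
      have close: "\<bar>h z - h x\<bar> \<le> L / B" if "z = real i / B \<or> z = real (Suc i) / B" for z
      proof -
        have "z \<in> {0..1}" "x \<in> {0..1}" using that cell_ends x(1) A by auto
        from lipschitz_onD[OF lip this] have "\<bar>h z - h x\<bar> \<le> L * \<bar>z - x\<bar>"
          by (simp only: dist_real_def)
        also have "\<dots> \<le> L * (1 / B)"
          using that x w L by (intro mult_left_mono) auto
        finally show ?thesis by simp
      qed
      have "\<bar>y v - h x\<bar> \<le> L / B" "\<bar>y (Suc v) - h x\<bar> \<le> L / B"
        using close unfolding Suc_y unfolding y_def i_def by blast+
      then have "\<bar>t - h x\<bar> \<le> L / B"
        using t by (auto simp: closed_segment_eq_real_ivl split: if_splits)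
      then show "t \<in> G"
        using bspec[OF near x(1)] by (auto simp: B_def dist_real_def abs_minus_commute)
    qed
  qed (use \<delta> B in auto)
  have var: "(\<Sum>v<2 ^ d. (y (Suc v) - y v)\<^sup>2) - (y (2 ^ d) - y 0)\<^sup>2 / real (2 ^ d) = block_variance h a d u"
    unfolding block_variance_def ends Suc_y by (simp add: y_def B_def)
  \<comment> \<open>Rescaling leaves one factor \<open>B\<close>, which is the weight of the
    variance in \<open>energy_diff\<close>.\<close>
  have const: "(L / B + \<delta> / B / 2) * (4 / (\<delta> / B)\<^sup>2) = (L + \<delta> / 2) * (4 / \<delta>\<^sup>2) * B"
    using B \<delta> by (simp add: field_simps power2_eq_square)
  have "\<delta> / B / 2 * X = \<delta> / 2 * (X / B)" for X by simp
  with main[unfolded var const] show ?thesis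
    unfolding B_def[symmetric] by (simp only: mult.assoc)
qed

text \<open>On each coarse interval, separation of the endpoints selects one of \<open>f\<close>,
  \<open>g\<close> with slope at least \<delta>. The variance of the other is nonnegative and may be
  added, so the bound has the same form on every interval and sums to the two energy
  increments.\<close>

lemma measure_le_energy_increment:
  fixes f g :: "real \<Rightarrow> real"
  assumes \<delta>: "\<delta> > 0" and lip: "L-lipschitz_on {0..1} f" "L-lipschitz_on {0..1} g"
    and sep: "\<And>x y. x \<in> {0..1} \<Longrightarrow> y \<in> {0..1} \<Longrightarrow> \<delta> * \<bar>x - y\<bar> \<le> max \<bar>f x - f y\<bar> \<bar>g x - g y\<bar>"
    and A: "A \<subseteq> {0..1}"
    and G: "G \<in> lmeasurable" "measure lebesgue G \<le> r" "G' \<in> lmeasurable" "measure lebesgue G' \<le> r"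
    and near: "\<forall>x\<in>A. cball (f x) (L / 2 ^ (a + d)) \<subseteq> G"
              "\<forall>x\<in>A. cball (g x) (L / 2 ^ (a + d)) \<subseteq> G'"
  shows "measure lebesgue A \<le> 2 / \<delta> * (2 ^ a * r) + 8 / \<delta> ^ 3 * (L + \<delta> / 2) *
    ((energy f (a + d) - energy f a) + (energy g (a + d) - energy g a))"
proof -
  define B :: real where "B = 2 ^ (a + d)"
  define c where "c = (L + \<delta> / 2) * (4 / \<delta>\<^sup>2)"
  define V where "V = (\<lambda>u. B * block_variance f a d u + B * block_variance g a d u)"
  have c: "c \<ge> 0" unfolding c_def using lipschitz_on_nonneg[OF lip(1)] \<delta> by simp
  have block: "\<delta> / 2 * ((\<Sum>v<2 ^ d. of_bool (meets_cell A (a + d) (u * 2 ^ d + v))) / B) \<le> r + c * V u"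
    if u: "u < 2 ^ a" for u
  proof -
    have Vf: "c * (B * block_variance f a d u) \<le> c * V u" and Vg: "c * (B * block_variance g a d u) \<le> c * V u"
      unfolding V_def B_def using c
      by (intro mult_left_mono; simp add: block_variance_nonneg)+
    from sep[OF grid_points_in_unit(2,1)[OF u]] have "\<delta> / 2 ^ a \<le> max \<bar>f (real (Suc u) / 2 ^ a) - f (real u / 2 ^ a)\<bar>
        \<bar>g (real (Suc u) / 2 ^ a) - g (real u / 2 ^ a)\<bar>"
      by (simp add: diff_divide_distrib[symmetric] del: max_less_iff_conj)
    then consider "\<delta> / 2 ^ a \<le> \<bar>f (real (Suc u) / 2 ^ a) - f (real u / 2 ^ a)\<bar>"
      | "\<delta> / 2 ^ a \<le> \<bar>g (real (Suc u) / 2 ^ a) - g (real u / 2 ^ a)\<bar>"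
      by (auto simp only: le_max_iff_disj)
    then show ?thesis
    proof cases
      case 1
      from block_hits_le[where a=a and d=d, OF \<delta> lip(1) A G(1) near(1) u 1, folded B_def c_def] G(2) Vf
      show ?thesis by linarith
    next
      case 2
      from block_hits_le[where a=a and d=d, OF \<delta> lip(2) A G(3) near(2) u 2, folded B_def c_def] G(4) Vg
      show ?thesis by linarith
    qed
  qed
  have "\<delta> / 2 * measure lebesgue A \<le> \<delta> / 2 * ((\<Sum>i<2 ^ (a + d). of_bool (meets_cell A (a + d) i)) / B)"
    unfolding B_def using \<delta> by (intro mult_left_mono measure_le_cells A) auto
  also have "\<dots> = (\<Sum>u<2 ^ a. \<delta> / 2 * ((\<Sum>v<2 ^ d. of_bool (meets_cell A (a + d) (u * 2 ^ d + v))) / B))"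
    unfolding power_add[of "2 :: nat"] sum_lessThan_blocks
    by (simp only: sum_divide_distrib[symmetric] sum_distrib_left[symmetric])
  also have "\<dots> \<le> (\<Sum>u<(2::nat) ^ a. r + c * V u)"
    by (intro sum_mono block) simp
  also have "\<dots> = 2 ^ a * r + c * (\<Sum>u<2 ^ a. V u)"
    by (simp add: sum.distrib sum_distrib_left)
  also have "(\<Sum>u<2 ^ a. V u) = (energy f (a + d) - energy f a) + (energy g (a + d) - energy g a)"
    by (simp add: V_def B_def energy_diff sum.distrib sum_distrib_left)
  finally have "\<delta> / 2 * measure lebesgue A
      \<le> 2 ^ a * r + c * ((energy f (a + d) - energy f a) + (energy g (a + d) - energy g a))" .
  then have "2 / \<delta> * (\<delta> / 2 * measure lebesgue A)
      \<le> 2 / \<delta> * (2 ^ a * r + c * ((energy f (a + d) - energy f a) + (energy g (a + d) - energy g a)))"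
    using \<delta> by (intro mult_left_mono) auto
  then show ?thesis
    using \<delta> by (simp add: c_def field_simps power2_eq_square power3_eq_cube)
qed

section \<open>Selection of scales and the measure bound along one graph\<close>

lemma ex_small_increment:
  fixes S :: "nat \<Rightarrow> real"
  assumes "W > 0" and "mono S" and "\<And>j. 0 \<le> S j" "\<And>j. S j \<le> B"
    and "\<And>w. w < W \<Longrightarrow> hi w \<le> lo (Suc w)"
  shows "\<exists>w<W. S (hi w) - S (lo w) \<le> B / W"
proof (rule ccontr)
  assume "\<not> ?thesis"
  \<comment> \<open>The windows are disjoint and \<open>S\<close> is monotone, so each increment is
    at most the one from \<open>lo w\<close> to \<open>lo (Suc w)\<close>; the latter telescope to
    at most \<open>B\<close>.\<close>
  then have "B / W < S (lo (Suc w)) - S (lo w)" if "w < W" for w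
    using that monoD[OF assms(2) assms(5)[OF that]] by fastforce
  then have "(\<Sum>w<W. B / W) < (\<Sum>w<W. S (lo (Suc w)) - S (lo w))"
    using assms(1) by (intro sum_strict_mono) auto
  also have "\<dots> = S (lo W) - S (lo 0)"
    by (simp add: sum_lessThan_telescope[where f="\<lambda>w. S (lo w)"])
  also have "\<dots> \<le> B" using assms(3)[of "lo 0"] assms(4)[of "lo W"] by linarith
  finally show False using assms(1) by simp
qed

text \<open>The bound on \<open>emeasure\<close> excludes infinite measure, for which
  \<open>measure\<close> would be 0 by convention.\<close>

lemma open_nbhd_lmeasurable:
  assumes "emeasure lborel (open_nbhd \<epsilon> P) \<le> ennreal c" "c \<ge> 0"
  shows "open_nbhd \<epsilon> P \<in> lmeasurable" "measure lebesgue (open_nbhd \<epsilon> P) \<le> c"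
proof -
  have "open (open_nbhd \<epsilon> P)" unfolding open_nbhd_def by blast
  then have "open_nbhd \<epsilon> P \<in> sets lborel" by simp
  then have eq: "emeasure lebesgue (open_nbhd \<epsilon> P) = emeasure lborel (open_nbhd \<epsilon> P)"
    by simp
  show "open_nbhd \<epsilon> P \<in> lmeasurable"
    using \<open>open (open_nbhd \<epsilon> P)\<close> assms(1) eq
    by (intro fmeasurableI) (auto simp: lborelD less_top[symmetric] top_unique)
  show "measure lebesgue (open_nbhd \<epsilon> P) \<le> c"
    unfolding measure_def eq using enn2real_mono[OF assms(1)] assms(2) by simp
qed

lemma cball_subset_open_nbhd:
  assumes "p \<in> P" "\<bar>y - p\<bar> \<le> \<epsilon>" "\<rho> + \<epsilon> < \<epsilon>'"
  shows "cball y \<rho> \<subseteq> open_nbhd \<epsilon>' P"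
proof -
  have "cball y \<rho> \<subseteq> ball p \<epsilon>'"
    using assms(2,3) by (auto simp: dist_real_def)
  then show ?thesis using assms(1) unfolding open_nbhd_def by blast
qed

lemma ex_power2_between:
  fixes T :: real
  assumes "T \<ge> 1"
  shows "\<exists>m. T \<le> 2 ^ m \<and> 2 ^ m \<le> 2 * T"
proof -
  define m where "m = (LEAST m. T \<le> 2 ^ m)"
  have ex: "\<exists>m. T \<le> 2 ^ m"
    using real_arch_pow[of 2 T] by (auto intro: less_imp_le)
  have "T \<le> 2 ^ m" unfolding m_def using ex by (rule LeastI_ex)
  moreover have "2 ^ m \<le> 2 * T"
  proof (cases m)
    case (Suc k)
    then have "\<not> T \<le> 2 ^ k" using not_less_Least[of k "\<lambda>m. T \<le> 2 ^ m"] by (simp add: m_def)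
    then show ?thesis using Suc by simp
  qed (use assms in simp)
  ultimately show ?thesis by blast
qed

text \<open>The energy is of order \<open>T\<^sup>2\<close> and its growth is later multiplied by a
  factor of order \<open>T\<close>, so a final bound of order \<open>1 / T\<close> asks for
  \<open>T ^ 4\<close> windows. Each uses \<open>2 * m + 4\<close> indices, which is of order at
  most \<open>T\<close>, so the total is of order \<open>T ^ 5\<close>, well below
  \<open>T ^ 100\<close>.\<close>

lemma window_count:
  fixes T :: real
  assumes T: "T \<ge> 2" and m: "2 ^ m \<le> 2 * T" and N: "real N = T ^ 100"
  shows "\<exists>W>0. T ^ 4 \<le> real W \<and> m + 1 + W * (2 * m + 4) \<le> N"
proof -
  define W where "W = nat \<lceil>T ^ 4\<rceil>"
  have T4: "T ^ 4 \<ge> 1" using T by (intro one_le_power) simp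
  have W: "T ^ 4 \<le> real W" unfolding W_def by (rule real_nat_ceiling_ge)
  moreover have W': "real W \<le> 2 * T ^ 4"
    using T4 of_int_ceiling_le_add_one[of "T ^ 4"] unfolding W_def by (simp; linarith)
  have "real m \<le> 2 ^ m" by (metis less_imp_le of_nat_less_two_power)
  then have m': "real m \<le> 2 * T" using m by linarith
  have "real (m + 1 + W * (2 * m + 4)) = real m + 1 + real W * (2 * real m + 4)" by simp
  also have "\<dots> \<le> 2 * T + 1 + 2 * T ^ 4 * (2 * (2 * T) + 4)"
    using W' m' T by (intro add_mono mult_mono) auto
  also have "\<dots> \<le> 32 * T ^ 5"
  proof -
    have "T * 1 \<le> T * T ^ 4" using T4 T by (intro mult_left_mono) auto
    moreover have "T ^ 4 * 2 \<le> T ^ 4 * T" using T by (intro mult_left_mono) auto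
    moreover have "T ^ 5 = T * T ^ 4" by (simp add: power_numeral_reduce)
    ultimately show ?thesis using T T4 by (simp only: algebra_simps)
  qed
  also have "\<dots> \<le> T ^ 95 * T ^ 5"
  proof (rule mult_right_mono)
    have "(32 :: real) \<le> 2 ^ 95" by simp
    also have "\<dots> \<le> T ^ 95" using T by (intro power_mono) auto
    finally show "32 \<le> T ^ 95" .
  qed (use T in simp)
  also have "\<dots> = real N" unfolding N power_add[symmetric] by simp
  finally have "m + 1 + W * (2 * m + 4) \<le> N" by (simp only: of_nat_le_iff)
  moreover have "W > 0" using W T4 by (intro gr0I) auto
  ultimately show ?thesis using W by blast
qed

lemma add_le_of_strict_steps:
  fixes j :: "nat \<Rightarrow> nat"
  assumes "\<And>n. k \<le> n \<Longrightarrow> n < N \<Longrightarrow> j n < j (n + 1)" "k \<le> n" "n + q \<le> N"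
  shows "j n + q \<le> j (n + q)"
  using assms(3)
proof (induction q)
  case (Suc q)
  then show ?case using assms(1)[of "n + q"] assms(2) by simp
qed simp

text \<open>Both losses in \<open>measure_le_energy_increment\<close> become of order
  \<open>1 / T\<close>: the measure term because the coarse length is \<open>2 ^ m * r n\<close>
  with \<open>2 ^ m\<close> comparable to \<open>T\<close>, the energy term by the choice of the
  window.\<close>

lemma measure_le_of_small_neighbourhoods:
  fixes f g :: "real \<Rightarrow> real" and r :: "nat \<Rightarrow> real"
  assumes \<delta>: "0 < \<delta>" "\<delta> \<le> 1 / 2" and T: "T \<ge> 1" "real N = T ^ 100"
    and lip: "(T + 1)-lipschitz_on {0..1} f" "(T + 1)-lipschitz_on {0..1} g"
    and sep: "\<And>x y. x \<in> {0..1} \<Longrightarrow> y \<in> {0..1} \<Longrightarrow> \<delta> * \<bar>x - y\<bar> \<le> max \<bar>f x - f y\<bar> \<bar>g x - g y\<bar>"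
    and A: "A \<subseteq> {0..1}"
    and near: "\<And>x. x \<in> A \<Longrightarrow> \<exists>p\<in>P. \<bar>f x - p\<bar> \<le> r N" "\<And>x. x \<in> A \<Longrightarrow> \<exists>p\<in>Q. \<bar>g x - p\<bar> \<le> r N"
    and decr: "\<And>n. 1 \<le> n \<Longrightarrow> n < N \<Longrightarrow> r (n + 1) < r n"
    and dyadic: "\<And>n. 1 \<le> n \<Longrightarrow> n \<le> N \<Longrightarrow> \<exists>j::nat. r n = 1 / 2 ^ j"
    and small: "\<And>n. 1 \<le> n \<Longrightarrow> n < N \<Longrightarrow> emeasure lborel (open_nbhd (r (n + 1)) P) \<le> ennreal (r n)"
      "\<And>n. 1 \<le> n \<Longrightarrow> n < N \<Longrightarrow> emeasure lborel (open_nbhd (r (n + 1)) Q) \<le> ennreal (r n)"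
  shows "measure lebesgue A \<le> (2 + 2 / \<delta> + 160 / \<delta> ^ 3) / T"
proof (cases "T \<ge> 2")
  case False
  \<comment> \<open>For \<open>T < 2\<close> the trivial bound suffices; this is the source of the
    summand 2 in the constant.\<close>
  have "measure lebesgue A \<le> 1"
  proof (cases "A \<in> sets lebesgue")
    case True
    then have "measure lebesgue A \<le> measure lebesgue {0..1::real}"
      using A by (intro measure_mono_fmeasurable) auto
    then show ?thesis by simp
  qed (simp add: measure_notin_sets)
  also have "1 \<le> 2 / T" using T False by simp
  also have "\<dots> \<le> (2 + 2 / \<delta> + 160 / \<delta> ^ 3) / T"
    using \<delta> T by (intro divide_right_mono) auto
  finally show ?thesis .
next
  case T2: True
  obtain m where m: "T \<le> 2 ^ m" "2 ^ m \<le> 2 * T"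
    using ex_power2_between[OF T(1)] by blast
  \<comment> \<open>Window \<open>w\<close> runs from \<open>2\<^sup>m r\<^sub>n\<close> down to \<open>2\<^sup>-\<^sup>m\<^sup>-\<^sup>3 r\<^sub>n\<^sub>+\<^sub>1\<close>, where \<open>n = s w\<close>; the step \<open>2 m + 4\<close> of \<open>s\<close> makes
    the windows disjoint.\<close>
  obtain W where W: "W > 0" "T ^ 4 \<le> real W" "m + 1 + W * (2 * m + 4) \<le> N"
    using window_count[OF T2 m(2) T(2)] by blast
  obtain j where j: "\<And>n. 1 \<le> n \<Longrightarrow> n \<le> N \<Longrightarrow> r n = 1 / 2 ^ j n"
    using dyadic by metis
  have jstep: "j n < j (n + 1)" if "1 \<le> n" "n < N" for n
  proof -
    have "(1::real) / 2 ^ j (n + 1) < 1 / 2 ^ j n"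
      using decr[OF that] j[of n] j[of "n + 1"] that by simp
    then have "(2::real) ^ j n < 2 ^ j (n + 1)"
      by (simp add: divide_less_eq less_divide_eq)
    then show ?thesis by (rule power_less_imp_less_exp[rotated]) simp
  qed
  note jadd = add_le_of_strict_steps[where k=1 and j=j and N=N, OF jstep]
  define s where "s = (\<lambda>w. m + 1 + w * (2 * m + 4))"
  define lo where "lo = (\<lambda>w. j (s w) - m)"
  define hi where "hi = (\<lambda>w. j (s w + 1) + m + 3)"
  have s_bound: "s w + (2 * m + 4) \<le> N" if "w < W" for w
  proof -
    have "Suc w * (2 * m + 4) \<le> W * (2 * m + 4)" using that by (intro mult_right_mono) auto
    then show ?thesis using W(3) by (simp add: s_def)
  qed
  \<comment> \<open>The offset \<open>m + 1\<close> in \<open>s\<close> makes the natural-number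
    subtraction in \<open>lo\<close> an honest one.\<close>
  have m_le_j: "m \<le> j (s w)" if "s w \<le> N" for w
    using jadd[of 1 "m + w * (2 * m + 4)"] that by (simp add: s_def)
  \<comment> \<open>Each index raises the exponent \<open>j\<close> by at least 1. The
    \<open>2 * m + 3\<close> indices between the windows pay for the \<open>m + 3\<close> in
    \<open>hi\<close> and the \<open>m\<close> in \<open>lo\<close>.\<close>
  have hi_lo: "hi w \<le> lo (Suc w)" if "w < W" for w
  proof -
    have "s (Suc w) = s w + 1 + (2 * m + 3)" by (simp add: s_def)
    then show ?thesis
      using jadd[of "s w + 1" "2 * m + 3"] s_bound[OF that] by (simp add: hi_def lo_def)
  qed
  \<comment> \<open>One window has to serve both functions, hence the sum of the energies.\<close>
  define S where "S = (\<lambda>i. energy f i + energy g i)"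
  have "\<exists>w<W. S (hi w) - S (lo w) \<le> 2 * (T + 1)\<^sup>2 / W"
  proof (rule ex_small_increment[OF W(1)])
    show "mono S" unfolding S_def by (intro monoI add_mono energy_mono)
    show "0 \<le> S i" "S i \<le> 2 * (T + 1)\<^sup>2" for i
      using energy_nonneg[of f i] energy_nonneg[of g i]
        energy_le_square_lipschitz[OF lip(1), of i] energy_le_square_lipschitz[OF lip(2), of i]
      unfolding S_def by linarith+
  qed (rule hi_lo)
  then obtain w where w: "w < W" and incr: "S (hi w) - S (lo w) \<le> 2 * (T + 1)\<^sup>2 / W" by blast
  define n where "n = s w"
  have n: "1 \<le> n" "n + 1 < N" using s_bound[OF w] by (auto simp: n_def s_def)
  have rn: "r n = 1 / 2 ^ j n" "r (n + 1) = 1 / 2 ^ j (n + 1)" "r N = 1 / 2 ^ j N"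
    using j n by auto
  have mj: "m \<le> j n" using m_le_j[of w] n by (simp add: n_def)
  have "lo w \<le> hi w"
    using jstep[of n] n by (simp add: lo_def hi_def n_def)
  then obtain d where d: "hi w = lo w + d" using le_Suc_ex by blast
  have "j (n + 1) + 1 \<le> j N"
    using jadd[of "n + 1" "N - (n + 1)"] n by simp
  then have "(2::real) ^ (j (n + 1) + 1) \<le> 2 ^ j N" by (intro power_increasing) auto
  then have rN: "r N \<le> r (n + 1) / 2"
    unfolding rn by (simp add: field_simps)
  \<comment> \<open>The 3 in \<open>hi\<close> makes the oscillation on a fine cell at most a
    quarter of \<open>r (n + 1)\<close>. Together with the half taken by \<open>r N\<close> it stays
    inside the open neighbourhood.\<close>
  have "(T + 1) / 2 ^ hi w \<le> (2 * 2 ^ m) / 2 ^ hi w"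
    using T(1) m(1) by (intro divide_right_mono) auto
  also have "\<dots> = r (n + 1) / 4"
    unfolding rn hi_def n_def[symmetric] by (simp add: power_add)
  finally have "(T + 1) / 2 ^ hi w \<le> r (n + 1) / 4" .
  moreover have rn1: "0 < r (n + 1)" unfolding rn by simp
  ultimately have rho: "(T + 1) / 2 ^ hi w + r N < r (n + 1)"
    using rN rn1 by linarith
  have rn0: "0 \<le> r n" unfolding rn by simp
  have sm: "emeasure lborel (open_nbhd (r (n + 1)) P) \<le> ennreal (r n)"
     "emeasure lborel (open_nbhd (r (n + 1)) Q) \<le> ennreal (r n)"
    using small n by auto
  have "measure lebesgue A \<le> 2 / \<delta> * (2 ^ lo w * r n) + 8 / \<delta> ^ 3 * (T + 1 + \<delta> / 2) *
    ((energy f (lo w + d) - energy f (lo w)) + (energy g (lo w + d) - energy g (lo w)))"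
  proof (rule measure_le_energy_increment[OF \<delta>(1) lip sep A
        open_nbhd_lmeasurable[OF sm(1) rn0] open_nbhd_lmeasurable[OF sm(2) rn0]])
    show "\<forall>x\<in>A. cball (f x) ((T + 1) / 2 ^ (lo w + d)) \<subseteq> open_nbhd (r (n + 1)) P"
      using near(1) cball_subset_open_nbhd rho unfolding d by metis
    show "\<forall>x\<in>A. cball (g x) ((T + 1) / 2 ^ (lo w + d)) \<subseteq> open_nbhd (r (n + 1)) Q"
      using near(2) cball_subset_open_nbhd rho unfolding d by metis
  qed
  also have "(energy f (lo w + d) - energy f (lo w)) + (energy g (lo w + d) - energy g (lo w))
      = S (hi w) - S (lo w)"
    by (simp add: S_def d)
  also have "2 ^ lo w * r n = 1 / 2 ^ m"
    unfolding rn lo_def n_def[symmetric] using mj by (simp add: power_diff)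
  finally have "measure lebesgue A \<le> 2 / \<delta> * (1 / 2 ^ m)
      + 8 / \<delta> ^ 3 * (T + 1 + \<delta> / 2) * (S (hi w) - S (lo w))" .
  also have "\<dots> \<le> 2 / \<delta> * (1 / T) + 8 / \<delta> ^ 3 * (5 / 2 * T) * (8 / T\<^sup>2)"
  proof (intro add_mono mult_mono mult_left_mono)
    show "1 / 2 ^ m \<le> 1 / T" using m T by (simp add: frac_le)
    show "T + 1 + \<delta> / 2 \<le> 5 / 2 * T" using T2 \<delta> by simp
    have "2 * (T + 1)\<^sup>2 / W \<le> 2 * (2 * T)\<^sup>2 / T ^ 4"
      using W T by (intro frac_le mult_left_mono power_mono) auto
    also have "\<dots> = 8 / T\<^sup>2" using T by (simp add: field_simps power_numeral_reduce)
    finally show "S (hi w) - S (lo w) \<le> 8 / T\<^sup>2" using incr by linarith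
    show "0 \<le> S (hi w) - S (lo w)"
      unfolding S_def d using energy_mono[of "lo w" "lo w + d" f] energy_mono[of "lo w" "lo w + d" g] by simp
  qed (use \<delta> T in auto)
  also have "\<dots> = (2 / \<delta> + 160 / \<delta> ^ 3) / T"
    using T \<delta> by (simp add: field_simps power2_eq_square)
  also have "\<dots> \<le> (2 + 2 / \<delta> + 160 / \<delta> ^ 3) / T"
    using T by (intro divide_right_mono) auto
  finally show ?thesis .
qed

section \<open>Transversality of the two projections along graphs in both coordinate
  directions\<close>

lemma deriv_bound_imp_nonexpansive:
  fixes \<gamma> :: "real \<Rightarrow> real"
  assumes "\<And>t. (\<gamma> has_real_derivative deriv \<gamma> t) (at t)" "\<And>t. \<bar>deriv \<gamma> t\<bar> \<le> 1"
  shows "\<bar>\<gamma> x - \<gamma> y\<bar> \<le> \<bar>x - y\<bar>"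
  using field_differentiable_bound[of UNIV \<gamma> "deriv \<gamma>" 1 x y] assms by auto

text \<open>Subtracting the two projections of a point cancels its second coordinate and leaves
  \<open>\<gamma> (\<alpha> - x) - \<gamma> (\<alpha>' - x)\<close>. The mean value theorem bounds
  the increments of this function from below.\<close>

lemma translate_difference_increment:
  fixes \<gamma> :: "real \<Rightarrow> real"
  assumes d: "\<And>t. (\<gamma> has_real_derivative deriv \<gamma> t) (at t)"
    and sep: "\<And>z. z \<in> {0..1} \<Longrightarrow> c \<le> \<bar>deriv \<gamma> (\<alpha> - z) - deriv \<gamma> (\<alpha>' - z)\<bar>"
    and "x \<in> {0..1}" "y \<in> {0..1}"
  shows "c * \<bar>x - y\<bar> \<le> \<bar>(\<gamma> (\<alpha> - x) - \<gamma> (\<alpha>' - x)) - (\<gamma> (\<alpha> - y) - \<gamma> (\<alpha>' - y))\<bar>"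
  using assms(3,4)
proof (induction x y rule: linorder_wlog)
  case (le x y)
  define u where "u = (\<lambda>z. \<gamma> (\<alpha> - z) - \<gamma> (\<alpha>' - z))"
  define u' where "u' = (\<lambda>z. deriv \<gamma> (\<alpha>' - z) - deriv \<gamma> (\<alpha> - z))"
  have du: "(u has_real_derivative u' z) (at z)" for z
    unfolding u_def u'_def by (rule derivative_eq_intros DERIV_chain2[OF d] refl | simp)+
  show ?case
  proof (cases "x = y")
    case False
    then obtain z where z: "x < z" "z < y" "u y - u x = (y - x) * u' z"
      using MVT2[of x y u u'] du le by auto
    have "z \<in> {0..1}" using z le by auto
    then have "c \<le> \<bar>u' z\<bar>" using sep[of z] by (simp add: u'_def abs_minus_commute)
    then have "c * \<bar>y - x\<bar> \<le> \<bar>u' z\<bar> * \<bar>y - x\<bar>" by (intro mult_right_mono) auto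
    also have "\<dots> = \<bar>u y - u x\<bar>" by (simp add: z abs_mult)
    finally show ?thesis by (simp add: u_def abs_minus_commute)
  qed simp
next
  case (sym x y)
  then show ?case by (simp add: abs_minus_commute)
qed

lemma abs_diff_le_Lip:
  assumes "Lipschitz_fun F" "Lip F \<le> K"
  shows "\<bar>F x - F y\<bar> \<le> K * \<bar>x - y\<bar>"
proof (cases "x = y")
  case False
  obtain L where L: "L-lipschitz_on UNIV F" using assms(1) unfolding Lipschitz_fun_def by blast
  have "bdd_above {\<bar>F x - F y\<bar> / \<bar>x - y\<bar> | x y. x \<noteq> y}"
  proof (rule bdd_aboveI)
    fix q assume "q \<in> {\<bar>F x - F y\<bar> / \<bar>x - y\<bar> | x y. x \<noteq> y}"
    then obtain x y where q: "q = \<bar>F x - F y\<bar> / \<bar>x - y\<bar>" "x \<noteq> y" by blast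
    show "q \<le> L"
      using lipschitz_onD[OF L, of x y] q by (simp add: dist_real_def divide_le_eq)
  qed
  then have "\<bar>F x - F y\<bar> / \<bar>x - y\<bar> \<le> Lip F"
    unfolding Lip_def using False by (intro cSup_upper) blast
  then have "\<bar>F x - F y\<bar> / \<bar>x - y\<bar> \<le> K" using assms(2) by linarith
  then show ?thesis using False by (simp add: divide_le_eq)
qed simp

lemma R_E_le:
  assumes "measure lebesgue {x \<in> J. \<exists>y\<in>{-\<epsilon>..\<epsilon>}. x *\<^sub>R fst \<omega> + (F x + y) *\<^sub>R snd \<omega> \<in> E} \<le> c"
    and "1 \<le> measure lebesgue J"
  shows "R_E E \<epsilon> J F \<omega> \<le> c"
proof -
  let ?A = "{x \<in> J. \<exists>y\<in>{-\<epsilon>..\<epsilon>}. x *\<^sub>R fst \<omega> + (F x + y) *\<^sub>R snd \<omega> \<in> E}"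
  have "R_E E \<epsilon> J F \<omega> \<le> measure lebesgue ?A / 1"
    unfolding R_E_def using assms(2) by (intro divide_left_mono) auto
  then show ?thesis using assms(1) by simp
qed


lemma le_max_abs_if_le_abs_diff:
  fixes p q c :: real
  assumes "2 * c \<le> \<bar>p - q\<bar>"
  shows "c \<le> max \<bar>p\<bar> \<bar>q\<bar>"
  using assms by linarith

text \<open>Moving a point by \<open>y\<close> along a coordinate axis changes \<open>Phi\<close> by
  at most \<open>\<bar>y\<bar>\<close>, since \<gamma> is nonexpansive. Points of the graph that are
  \<open>r N\<close>-close to \<open>E\<close> along the axis therefore have projections
  \<open>r N\<close>-close to those of \<open>E\<close>. The 4 in the separation hypothesis pays
  twice a factor 2: for passing from a difference to a maximum, and for the threshold between flat
  and steep pieces of a graph over the second axis.\<close>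

lemma R_res_le_of_small_projections:
  fixes \<gamma> :: "real \<Rightarrow> real" and r :: "nat \<Rightarrow> real"
  assumes \<gamma>: "\<And>t. (\<gamma> has_real_derivative deriv \<gamma> t) (at t)" "\<And>t. \<bar>deriv \<gamma> t\<bar> \<le> 1"
    and sep: "\<And>z. z \<in> {0..1} \<Longrightarrow> 4 * \<delta> \<le> \<bar>deriv \<gamma> (\<alpha> - z) - deriv \<gamma> (\<alpha>' - z)\<bar>"
    and \<delta>: "0 < \<delta>"
    and E: "E \<subseteq> {0..1} \<times> {0..1}" and N: "N \<ge> 1"
    and decr: "\<And>n. 1 \<le> n \<Longrightarrow> n < N \<Longrightarrow> r (n + 1) < r n"
    and dyadic: "\<And>n. 1 \<le> n \<Longrightarrow> n \<le> N \<Longrightarrow> \<exists>j::nat. r n = 1 / 2 ^ j"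
    and small: "\<And>n. 1 \<le> n \<Longrightarrow> n < N \<Longrightarrow> emeasure lborel (open_nbhd (r (n + 1)) (Phi \<gamma> \<alpha> ` E)) \<le> ennreal (r n)"
      "\<And>n. 1 \<le> n \<Longrightarrow> n < N \<Longrightarrow> emeasure lborel (open_nbhd (r (n + 1)) (Phi \<gamma> \<alpha>' ` E)) \<le> ennreal (r n)"
  shows "R_res E (r N) 1 (real N powr (1 / 100)) \<le> (2 + 2 / \<delta> + 160 / \<delta> ^ 3) * real N powr (- 1 / 100)"
proof -
  define T where "T = real N powr (1 / 100)"
  have T: "T \<ge> 1" unfolding T_def using N by (intro ge_one_powr_ge_zero) auto
  have TN: "real N = T ^ 100"
    unfolding T_def using N by (simp add: powr_powr flip: powr_realpow)
  have Tinv: "real N powr (- 1 / 100) = 1 / T"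
    unfolding T_def by (simp add: powr_minus_divide)
  define C where "C = (2 + 2 / \<delta> + 160 / \<delta> ^ 3) / T"
  have \<gamma>1: "\<bar>\<gamma> x - \<gamma> y\<bar> \<le> \<bar>x - y\<bar>" for x y
    by (rule deriv_bound_imp_nonexpansive[OF \<gamma>])
  note incr = translate_difference_increment[OF \<gamma>(1) sep]
  \<comment> \<open>Two derivatives of size at most 1 differ by at most 2.\<close>
  have \<delta>2: "\<delta> \<le> 1 / 2"
    using sep[of 0] \<gamma>(2)[of \<alpha>] \<gamma>(2)[of \<alpha>'] by (simp; linarith)
  note main = measure_le_of_small_neighbourhoods[OF \<delta> \<delta>2 T TN, folded C_def]
  have "max (R_E E (r N) J F ((1, 0), (0, 1))) (R_E E (r N) J F ((0, 1), (1, 0))) \<le> C"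
    if J: "1 \<le> measure lebesgue J" and F: "Lipschitz_fun F" "Lip F \<le> T" for J F
  proof -
    have lipF: "\<bar>F x - F y\<bar> \<le> T * \<bar>x - y\<bar>" for x y
      by (rule abs_diff_le_Lip[OF F])
    have "R_E E (r N) J F ((1, 0), (0, 1)) \<le> C"
    proof (rule R_E_le[OF _ J], rule main[where f="\<lambda>x. Phi \<gamma> \<alpha> (x, F x)" and g="\<lambda>x. Phi \<gamma> \<alpha>' (x, F x)"])
      have "\<bar>Phi \<gamma> l (x, F x) - Phi \<gamma> l (y, F y)\<bar> \<le> (T + 1) * \<bar>x - y\<bar>" for l x y
        using lipF[of x y] \<gamma>1[of "l - x" "l - y"] unfolding Phi_def by (simp add: algebra_simps)
      then show "(T + 1)-lipschitz_on {0..1} (\<lambda>x. Phi \<gamma> \<alpha> (x, F x))"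
        "(T + 1)-lipschitz_on {0..1} (\<lambda>x. Phi \<gamma> \<alpha>' (x, F x))"
        using T by (auto intro!: lipschitz_onI simp: dist_real_def)
      show "\<delta> * \<bar>x - y\<bar> \<le> max \<bar>Phi \<gamma> \<alpha> (x, F x) - Phi \<gamma> \<alpha> (y, F y)\<bar>
          \<bar>Phi \<gamma> \<alpha>' (x, F x) - Phi \<gamma> \<alpha>' (y, F y)\<bar>" if "x \<in> {0..1}" "y \<in> {0..1}" for x y
      proof -
        have "2 * (\<delta> * \<bar>x - y\<bar>) \<le> 4 * \<delta> * \<bar>x - y\<bar>" using \<delta> by simp
        also note incr[OF _ that]
        finally show ?thesis
          unfolding Phi_def fst_conv snd_conv by (intro le_max_abs_if_le_abs_diff) (simp add: algebra_simps)
      qed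
      have near: "\<exists>p\<in>Phi \<gamma> l ` E. \<bar>Phi \<gamma> l (x, F x) - p\<bar> \<le> r N"
        if x: "x \<in> {x \<in> J. \<exists>y\<in>{- r N..r N}. x *\<^sub>R fst ((1, 0), (0, 1)) + (F x + y) *\<^sub>R snd ((1, 0), (0, 1)) \<in> E}"
        for l x
      proof -
        obtain y where y: "- r N \<le> y \<and> y \<le> r N" "(x, F x + y) \<in> E" using x by auto
        then have "\<bar>Phi \<gamma> l (x, F x) - Phi \<gamma> l (x, F x + y)\<bar> \<le> r N"
          unfolding Phi_def by auto
        then show ?thesis using y(2) by blast
      qed
      show "\<exists>p\<in>Phi \<gamma> \<alpha> ` E. \<bar>Phi \<gamma> \<alpha> (x, F x) - p\<bar> \<le> r N"
        "\<exists>p\<in>Phi \<gamma> \<alpha>' ` E. \<bar>Phi \<gamma> \<alpha>' (x, F x) - p\<bar> \<le> r N"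
        if "x \<in> {x \<in> J. \<exists>y\<in>{- r N..r N}. x *\<^sub>R fst ((1, 0), (0, 1)) + (F x + y) *\<^sub>R snd ((1, 0), (0, 1)) \<in> E}" for x
        by (rule near[OF that])+
    qed (use E decr dyadic small in auto)
    moreover have "R_E E (r N) J F ((0, 1), (1, 0)) \<le> C"
    proof -
      \<comment> \<open>Clipping \<open>F\<close> keeps \<open>\<alpha> - F x\<close> in the interval where \<open>\<gamma>'\<close> is bi-Lipschitz, without moving
        the graph away from \<open>E\<close>.\<close>
      define G where "G = (\<lambda>x. max 0 (min 1 (F x)))"
      have G01: "G x \<in> {0..1}" for x unfolding G_def by auto
      have GF: "\<bar>G x - t\<bar> \<le> \<bar>F x - t\<bar>" if "t \<in> {0..1}" for x t
        using that unfolding G_def by auto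
      have lipG: "\<bar>G x - G y\<bar> \<le> T * \<bar>x - y\<bar>" for x y
        using lipF[of x y] unfolding G_def by linarith
      show ?thesis
      proof (rule R_E_le[OF _ J], rule main[where f="\<lambda>x. Phi \<gamma> \<alpha> (G x, x)" and g="\<lambda>x. Phi \<gamma> \<alpha>' (G x, x)"])
        have "\<bar>Phi \<gamma> l (G x, x) - Phi \<gamma> l (G y, y)\<bar> \<le> (T + 1) * \<bar>x - y\<bar>" for l x y
          using lipG[of x y] \<gamma>1[of "l - G x" "l - G y"] unfolding Phi_def by (simp add: algebra_simps)
        then show "(T + 1)-lipschitz_on {0..1} (\<lambda>x. Phi \<gamma> \<alpha> (G x, x))"
          "(T + 1)-lipschitz_on {0..1} (\<lambda>x. Phi \<gamma> \<alpha>' (G x, x))"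
          using T by (auto intro!: lipschitz_onI simp: dist_real_def)
        show "\<delta> * \<bar>x - y\<bar> \<le> max \<bar>Phi \<gamma> \<alpha> (G x, x) - Phi \<gamma> \<alpha> (G y, y)\<bar>
            \<bar>Phi \<gamma> \<alpha>' (G x, x) - Phi \<gamma> \<alpha>' (G y, y)\<bar>" for x y
          \<comment> \<open>A flat piece of the graph is transversal to each projection separately; on a steep piece
            the two projections differ.\<close>
        proof (cases "\<bar>G x - G y\<bar> \<le> \<bar>x - y\<bar> / 2")
          case True
          have "\<bar>\<gamma> (\<alpha> - G x) - \<gamma> (\<alpha> - G y)\<bar> \<le> \<bar>x - y\<bar> / 2"
            using True \<gamma>1[of "\<alpha> - G x" "\<alpha> - G y"] by linarith
          then have half: "1 / 2 * \<bar>x - y\<bar> \<le> \<bar>x + \<gamma> (\<alpha> - G x) - (y + \<gamma> (\<alpha> - G y))\<bar>"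
            using abs_triangle_ineq2[of "x - y" "\<gamma> (\<alpha> - G y) - \<gamma> (\<alpha> - G x)"]
            by (simp add: abs_minus_commute algebra_simps)
          have "\<delta> * \<bar>x - y\<bar> \<le> 1 / 2 * \<bar>x - y\<bar>" using \<delta>2 by (intro mult_right_mono) auto
          also note half
          finally have "\<delta> * \<bar>x - y\<bar> \<le> \<bar>x + \<gamma> (\<alpha> - G x) - (y + \<gamma> (\<alpha> - G y))\<bar>" .
          then show ?thesis by (simp add: Phi_def le_max_iff_disj)
        next
          case False
          then have "4 * \<delta> * (\<bar>x - y\<bar> / 2) \<le> 4 * \<delta> * \<bar>G x - G y\<bar>" using \<delta> by (intro mult_left_mono) auto
          then have "2 * (\<delta> * \<bar>x - y\<bar>) \<le> 4 * \<delta> * \<bar>G x - G y\<bar>" by simp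
          also note incr[OF _ G01[of x] G01[of y]]
          finally show ?thesis
            unfolding Phi_def fst_conv snd_conv by (intro le_max_abs_if_le_abs_diff) (simp add: algebra_simps)
        qed
        have near: "\<exists>p\<in>Phi \<gamma> l ` E. \<bar>Phi \<gamma> l (G x, x) - p\<bar> \<le> r N"
          if x: "x \<in> {x \<in> J. \<exists>y\<in>{- r N..r N}. x *\<^sub>R fst ((0, 1), (1, 0)) + (F x + y) *\<^sub>R snd ((0, 1), (1, 0)) \<in> E}"
          for l x
        proof -
          obtain y where y: "- r N \<le> y \<and> y \<le> r N" "(F x + y, x) \<in> E" using x by auto
          then have "F x + y \<in> {0..1}" using E by auto
          then have "\<bar>G x - (F x + y)\<bar> \<le> r N" using GF[of "F x + y" x] y by auto
          then have "\<bar>Phi \<gamma> l (G x, x) - Phi \<gamma> l (F x + y, x)\<bar> \<le> r N"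
            using \<gamma>1[of "l - G x" "l - (F x + y)"] unfolding Phi_def by (simp; linarith)
          then show ?thesis using y(2) by blast
        qed
        show "\<exists>p\<in>Phi \<gamma> \<alpha> ` E. \<bar>Phi \<gamma> \<alpha> (G x, x) - p\<bar> \<le> r N"
          "\<exists>p\<in>Phi \<gamma> \<alpha>' ` E. \<bar>Phi \<gamma> \<alpha>' (G x, x) - p\<bar> \<le> r N"
          if "x \<in> {x \<in> J. \<exists>y\<in>{- r N..r N}. x *\<^sub>R fst ((0, 1), (1, 0)) + (F x + y) *\<^sub>R snd ((0, 1), (1, 0)) \<in> E}" for x
          by (rule near[OF that])+
      qed (use E decr dyadic small in auto)
    qed
    ultimately show ?thesis by simp
  qed
  then have "R_res E (r N) 1 T \<le> C"
    unfolding R_res_def using R_res_index_nonempty[of T 1] T by (intro cSup_least) auto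
  then show ?thesis unfolding C_def Tinv T_def[symmetric] by simp
qed

theorem theorem3p9:
  fixes M \<alpha> \<alpha>' :: real
  assumes "M > 0" and "\<alpha> \<noteq> \<alpha>'"
  shows "\<exists>C>0. \<forall>(I :: real set) (\<gamma> :: real \<Rightarrow> real) (\<Lambda> :: real set).
    is_interval I \<and> compact I \<and>
    \<gamma> C1_differentiable_on UNIV \<and>
    (\<forall>t. \<bar>deriv \<gamma> t\<bar> \<le> 1) \<and>
    (\<forall>s\<in>I. \<forall>t\<in>I. inverse M * \<bar>s - t\<bar> \<le> \<bar>deriv \<gamma> s - deriv \<gamma> t\<bar> \<and>
                 \<bar>deriv \<gamma> s - deriv \<gamma> t\<bar> \<le> M * \<bar>s - t\<bar>) \<and>
    strict_antimono_on I (deriv \<gamma>) \<and>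
    compact \<Lambda> \<and>
    {l - s | l s. l \<in> \<Lambda> \<and> s \<in> {0..1}} \<subseteq> I \<and>
    \<alpha> \<in> \<Lambda> \<and> \<alpha>' \<in> \<Lambda>
    \<longrightarrow>
    (\<forall>(E :: (real \<times> real) set) (N :: nat) (r :: nat \<Rightarrow> real).
      E \<subseteq> {0..1} \<times> {0..1} \<and> compact E \<and>
      N \<ge> 1 \<and>
      0 < r N \<and> (\<forall>n. 1 \<le> n \<and> n < N \<longrightarrow> r (n + 1) < r n) \<and> r 1 \<le> 1 \<and>
      (\<forall>n. 1 \<le> n \<and> n \<le> N \<longrightarrow> (\<exists>j::nat. r n = 1 / 2 ^ j)) \<and>
      (\<forall>n. 1 \<le> n \<and> n < N \<longrightarrow>
         emeasure lborel (open_nbhd (r (n + 1)) (Phi \<gamma> \<alpha> ` E)) \<le> ennreal (r n) \<and>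
         emeasure lborel (open_nbhd (r (n + 1)) (Phi \<gamma> \<alpha>' ` E)) \<le> ennreal (r n))
      \<longrightarrow>
      R_res E (r N) 1 (real N powr (1 / 100)) \<le> C * real N powr (- 1 / 100))"
proof -
  \<comment> \<open>For \<open>z\<close> in [0,1] the points \<open>\<alpha> - z\<close> and
    \<open>\<alpha>' - z\<close> lie in \<open>I\<close> at distance
    \<open>\<bar>\<alpha> - \<alpha>'\<bar>\<close>, so the lower bound on differences of
    \<open>deriv \<gamma>\<close> gives exactly \<open>4 * \<delta>\<close>. This depends on
    \<open>M\<close>, \<open>\<alpha>\<close> and \<open>\<alpha>'\<close> alone.\<close>
  define \<delta> where "\<delta> = \<bar>\<alpha> - \<alpha>'\<bar> / (4 * M)"
  have \<delta>: "\<delta> > 0" unfolding \<delta>_def using assms by simp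
  show ?thesis
  proof (intro exI[of _ "2 + 2 / \<delta> + 160 / \<delta> ^ 3"] conjI allI impI; (elim conjE)?)
    show "0 < 2 + 2 / \<delta> + 160 / \<delta> ^ 3" using \<delta> by (simp add: add_pos_pos)
  next
    fix I :: "real set" and \<gamma> :: "real \<Rightarrow> real" and \<Lambda> :: "real set"
      and E :: "(real \<times> real) set" and N :: nat and r :: "nat \<Rightarrow> real"
    assume C1: "\<gamma> C1_differentiable_on UNIV" and bound: "\<forall>t. \<bar>deriv \<gamma> t\<bar> \<le> 1"
      and bilip: "\<forall>s\<in>I. \<forall>t\<in>I. inverse M * \<bar>s - t\<bar> \<le> \<bar>deriv \<gamma> s - deriv \<gamma> t\<bar> \<and>
                 \<bar>deriv \<gamma> s - deriv \<gamma> t\<bar> \<le> M * \<bar>s - t\<bar>"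
      and sub: "{l - s | l s. l \<in> \<Lambda> \<and> s \<in> {0..1}} \<subseteq> I"
      and mem: "\<alpha> \<in> \<Lambda>" "\<alpha>' \<in> \<Lambda>"
      and E: "E \<subseteq> {0..1} \<times> {0..1}" "N \<ge> 1"
      and decr: "\<forall>n. 1 \<le> n \<and> n < N \<longrightarrow> r (n + 1) < r n"
      and dyadic: "\<forall>n. 1 \<le> n \<and> n \<le> N \<longrightarrow> (\<exists>j::nat. r n = 1 / 2 ^ j)"
      and small: "\<forall>n. 1 \<le> n \<and> n < N \<longrightarrow>
         emeasure lborel (open_nbhd (r (n + 1)) (Phi \<gamma> \<alpha> ` E)) \<le> ennreal (r n) \<and>
         emeasure lborel (open_nbhd (r (n + 1)) (Phi \<gamma> \<alpha>' ` E)) \<le> ennreal (r n)"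
    show "R_res E (r N) 1 (real N powr (1 / 100)) \<le> (2 + 2 / \<delta> + 160 / \<delta> ^ 3) * real N powr (- 1 / 100)"
    proof (rule R_res_le_of_small_projections[where \<gamma>=\<gamma> and \<alpha>=\<alpha> and \<alpha>'=\<alpha>'])
      show "(\<gamma> has_real_derivative deriv \<gamma> t) (at t)" for t
        using C1 unfolding C1_differentiable_on_eq
        by (simp add: DERIV_deriv_iff_real_differentiable)
      show "4 * \<delta> \<le> \<bar>deriv \<gamma> (\<alpha> - z) - deriv \<gamma> (\<alpha>' - z)\<bar>" if "z \<in> {0..1}" for z
      proof -
        have "\<alpha> - z \<in> I" "\<alpha>' - z \<in> I" using sub mem that by blast+
        with bilip have "inverse M * \<bar>(\<alpha> - z) - (\<alpha>' - z)\<bar> \<le> \<bar>deriv \<gamma> (\<alpha> - z) - deriv \<gamma> (\<alpha>' - z)\<bar>"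
          by blast
        then show ?thesis using assms(1) by (simp add: \<delta>_def field_simps)
      qed
    qed (use bound \<delta> E decr dyadic small in auto)
  qed
qed

end
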